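(* If a process $P$ reduces to a process $Q$ by the tick-last strategy, then $Q$ is in normal form for $\rightarrow$ and $Q\Rightarrow Q$. Moreover, $\lfloor P\rfloor\rightarrow^*\lfloor Q\rfloor$ and $\lfloor Q\rfloor$ is in normal form for $\rightarrow$.
   Context: Processes. Base variables $x,y,z,\dots$ and channel names $a,b,c,\dots$; $v$ ranges over both. Expressions: $e ::= v \mid \mathtt{0} \mid \mathtt{s}(e) \mid [\,] \mid e::e' \mid \mathtt{tt} \mid \mathtt{ff}$. Processes: $P,Q ::= 0 \mid P\mid Q \mid\ !a(\vec v).P \mid a(\vec v).P \mid \overline{a}\langle \vec e\rangle \mid (\nu a)P \mid \mathtt{match}\ e\ \{\mathtt{0}\mapsto P;\ \mathtt{s}(x)\mapsto Q\} \mid \mathtt{match}\ e\ \{[\,]\mapsto P;\ x::y\mapsto Q\} \mid \mathtt{if}\ e\ \mathtt{then}\ P\ \mathtt{else}\ Q \mid \mathtt{tick}.P$, up to $\alpha$-renaming; pre-processes are processes without $\mathtt{tick}$. Structural congruence $\equiv$: least congruence (closed under all constructors including $\mathtt{tick}$) with $P\mid0\equiv P$, $P\mid Q\equiv Q\mid P$, $P\mid(Q\mid R)\equiv(P\mid Q)\mid R$, $(\nu a)(\nu b)P\equiv(\nu b)(\nu a)P$, $(\nu a)(P\mid Q)\equiv(\nu a)P\mid Q$ if $a$ not free in $Q$. Reduction $\rightarrow$ (same rules on processes and pre-processes): $!a(\vec v).P\mid\overline a\langle\vec e\rangle\rightarrow\ !a(\vec v).P\mid P[\vec v:=\vec e]$;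 $a(\vec v).P\mid\overline a\langle\vec e\rangle\rightarrow P[\vec v:=\vec e]$; $\mathtt{match}\ \mathtt0\ \{\mathtt0\mapsto P;\mathtt s(x)\mapsto Q\}\rightarrow P$; $\mathtt{match}\ \mathtt s(e)\ \{\dots\}\rightarrow Q[x:=e]$; $\mathtt{match}\ [\,]\ \{[\,]\mapsto P;x::y\mapsto Q\}\rightarrow P$; $\mathtt{match}\ e::e'\ \{\dots\}\rightarrow Q[x,y:=e,e']$; $\mathtt{if}\ \mathtt{tt}\ \mathtt{then}\ P\ \mathtt{else}\ Q\rightarrow P$; $\mathtt{if}\ \mathtt{ff}\ \mathtt{then}\ P\ \mathtt{else}\ Q\rightarrow Q$; if $P\rightarrow Q$ then $P\mid R\rightarrow Q\mid R$ and $(\nu a)P\rightarrow(\nu a)Q$; if $P\equiv P'\rightarrow Q'\equiv Q$ then $P\rightarrow Q$. (Substitutions must replace names by names; no rule for $\mathtt{tick}.P$.) Time reduction $\Rightarrow$: $0\Rightarrow0$; any replicated input, input, output, $\mathtt{match}$ or $\mathtt{if}$ process reduces to itself; $\mathtt{tick}.P\Rightarrow P$; if $P\Rightarrow P'$ and $Q\Rightarrow Q'$ then $P\mid Q\Rightarrow P'\mid Q'$; if $P\Rightarrow P'$ then $(\nu a)P\Rightarrow(\nu a)P'$. Tick-last strategy: from $P$, reduce $P\rightarrow^*P'$ with $P'$ in normal form for $\rightarrow$; if $P'\Rightarrow P'$, stop with result $P'$; otherwise $P'\Rightarrow R$ with $R\ne P'$ and restart from $R$. "$P$ reduces to $Q$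 by the tick-last strategy" means a finite such run from $P$ stops with result $Q$. Tick erasure $\lfloor P\rfloor$: the pre-process obtained from $P$ by deleting every $\mathtt{tick}$ prefix, i.e. $\lfloor\mathtt{tick}.P\rfloor=\lfloor P\rfloor$ and $\lfloor\cdot\rfloor$ commutes with all other constructors (outputs unchanged). *)

theory Defs
  imports Main
begin

section \<open>Variables, expressions and processes\<close>

text \<open>
  Base variables and channel names are two disjoint countably infinite families; the letter
  v of the grammar ranges over both.
\<close>

datatype var = Base nat | Chan nat

datatype exp = Var var | Zero | Succ exp | ENil | ECons exp exp | TT | FF

datatype kind = KBase | KChan

fun kind_of :: "var \<Rightarrow> kind" where
  "kind_of (Base x) = KBase"
| "kind_of (Chan a) = KChan"

text \<open>
  Processes are considered up to alpha-renaming.  The datatype below consists of canonical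
  representatives of the alpha-classes: it is a de Bruijn syntax, with separate index spaces for
  base variables and for channel names, in which the index \<open>n\<close> of an occurrence that is not below
  any binder is the variable \<open>Base n\<close>, respectively \<open>Chan n\<close>, itself.  A binder for a vector only
  records the kinds of the bound variables; in its scope the \<open>i\<close>-th bound base variable is
  \<open>Base i\<close>, the \<open>i\<close>-th bound channel name is \<open>Chan i\<close>, and the outer variables are shifted.

  The constructors with suffix B are used only to build the type.  The semantics below is given
  through the named binding constructors \<open>inp\<close>, \<open>rep_inp\<close>, \<open>res\<close>, \<open>match_nat\<close>, \<open>match_list\<close>; the
  lemmas after their definition show that these behave as constructors modulo alpha-renaming.
\<close>

datatype proc =
    PNil
  | Par proc proc  (infixr \<open>\<parallel>\<close> 65)
  | RepInpB nat "kind list" proc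
  | InpB nat "kind list" proc
  | Out nat "exp list"
  | NuB proc
  | MatchNatB exp proc proc
  | MatchListB exp proc proc
  | Ite exp proc proc
  | Tick proc


section \<open>Substitution\<close>

text \<open>
  Simultaneous capture-avoiding substitution: \<open>\<beta>\<close> maps base variables to expressions and \<open>\<rho>\<close> maps
  channel names to channel names.  A substitution going below a binder of \<open>k\<close> base variables and
  \<open>l\<close> channel names is lifted accordingly.
\<close>

primrec vsubst :: "(nat \<Rightarrow> exp) \<Rightarrow> (nat \<Rightarrow> nat) \<Rightarrow> var \<Rightarrow> exp" where
  "vsubst \<beta> \<rho> (Base x) = \<beta> x"
| "vsubst \<beta> \<rho> (Chan a) = Var (Chan (\<rho> a))"

primrec esubst :: "(nat \<Rightarrow> exp) \<Rightarrow> (nat \<Rightarrow> nat) \<Rightarrow> exp \<Rightarrow> exp" where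
  "esubst \<beta> \<rho> (Var v) = vsubst \<beta> \<rho> v"
| "esubst \<beta> \<rho> Zero = Zero"
| "esubst \<beta> \<rho> (Succ e) = Succ (esubst \<beta> \<rho> e)"
| "esubst \<beta> \<rho> ENil = ENil"
| "esubst \<beta> \<rho> (ECons e e') = ECons (esubst \<beta> \<rho> e) (esubst \<beta> \<rho> e')"
| "esubst \<beta> \<rho> TT = TT"
| "esubst \<beta> \<rho> FF = FF"

definition lift_base :: "nat \<Rightarrow> nat \<Rightarrow> (nat \<Rightarrow> exp) \<Rightarrow> nat \<Rightarrow> exp" where
  "lift_base k l \<beta> n =
     (if n < k then Var (Base n)
      else esubst (\<lambda>x. Var (Base (k + x))) (\<lambda>a. l + a) (\<beta> (n - k)))"

definition lift_chan :: "nat \<Rightarrow> (nat \<Rightarrow> nat) \<Rightarrow> nat \<Rightarrow> nat" where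
  "lift_chan l \<rho> n = (if n < l then n else l + \<rho> (n - l))"

abbreviation nbase :: "kind list \<Rightarrow> nat" where
  "nbase ks \<equiv> count_list ks KBase"

abbreviation nchan :: "kind list \<Rightarrow> nat" where
  "nchan ks \<equiv> count_list ks KChan"

primrec psubst :: "(nat \<Rightarrow> exp) \<Rightarrow> (nat \<Rightarrow> nat) \<Rightarrow> proc \<Rightarrow> proc" where
  "psubst \<beta> \<rho> PNil = PNil"
| "psubst \<beta> \<rho> (P \<parallel> Q) = psubst \<beta> \<rho> P \<parallel> psubst \<beta> \<rho> Q"
| "psubst \<beta> \<rho> (RepInpB a ks P) =
     RepInpB (\<rho> a) ks (psubst (lift_base (nbase ks) (nchan ks) \<beta>) (lift_chan (nchan ks) \<rho>) P)"
| "psubst \<beta> \<rho> (InpB a ks P) =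
     InpB (\<rho> a) ks (psubst (lift_base (nbase ks) (nchan ks) \<beta>) (lift_chan (nchan ks) \<rho>) P)"
| "psubst \<beta> \<rho> (Out a es) = Out (\<rho> a) (map (esubst \<beta> \<rho>) es)"
| "psubst \<beta> \<rho> (NuB P) = NuB (psubst (lift_base 0 1 \<beta>) (lift_chan 1 \<rho>) P)"
| "psubst \<beta> \<rho> (MatchNatB e P Q) =
     MatchNatB (esubst \<beta> \<rho> e) (psubst \<beta> \<rho> P) (psubst (lift_base 1 0 \<beta>) (lift_chan 0 \<rho>) Q)"
| "psubst \<beta> \<rho> (MatchListB e P Q) =
     MatchListB (esubst \<beta> \<rho> e) (psubst \<beta> \<rho> P) (psubst (lift_base 2 0 \<beta>) (lift_chan 0 \<rho>) Q)"
| "psubst \<beta> \<rho> (Ite e P Q) = Ite (esubst \<beta> \<rho> e) (psubst \<beta> \<rho> P) (psubst \<beta> \<rho> Q)"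
| "psubst \<beta> \<rho> (Tick P) = Tick (psubst \<beta> \<rho> P)"

text \<open>
  The substitution of the calculus, \<open>P[vs ::= es]\<close>.  It is meaningful only if it is well-defined,
  that is, if the two vectors have the same length and channel names are replaced by channel
  names; all reduction rules carry this requirement.  No restriction is put on the expressions
  replacing base variables.
\<close>

definition subst_ok :: "var list \<Rightarrow> exp list \<Rightarrow> bool" where
  "subst_ok vs es \<longleftrightarrow>
     list_all2 (\<lambda>v e. \<forall>a. v = Chan a \<longrightarrow> (\<exists>b. e = Var (Chan b))) vs es"

definition subst_base :: "var list \<Rightarrow> exp list \<Rightarrow> nat \<Rightarrow> exp" where
  "subst_base vs es x =
     (case map_of (zip vs es) (Base x) of Some e \<Rightarrow> e | None \<Rightarrow> Var (Base x))"

definition subst_chan :: "var list \<Rightarrow> exp list \<Rightarrow> nat \<Rightarrow> nat" where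
  "subst_chan vs es a =
     (case map_of (zip vs es) (Chan a) of Some (Var (Chan b)) \<Rightarrow> b | _ \<Rightarrow> a)"

definition subst :: "proc \<Rightarrow> var list \<Rightarrow> exp list \<Rightarrow> proc"  (\<open>_[_ ::= _]\<close> [1000, 0, 0] 1000) where
  "P[vs ::= es] = psubst (subst_base vs es) (subst_chan vs es) P"


section \<open>Free variables\<close>

primrec fv_exp :: "exp \<Rightarrow> var set" where
  "fv_exp (Var v) = {v}"
| "fv_exp Zero = {}"
| "fv_exp (Succ e) = fv_exp e"
| "fv_exp ENil = {}"
| "fv_exp (ECons e e') = fv_exp e \<union> fv_exp e'"
| "fv_exp TT = {}"
| "fv_exp FF = {}"

text \<open>Removes the indices of the bound variables and undoes the shift of the remaining ones.\<close>

definition unshift :: "nat \<Rightarrow> nat \<Rightarrow> var set \<Rightarrow> var set" where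
  "unshift k l S = {Base x |x. Base (k + x) \<in> S} \<union> {Chan a |a. Chan (l + a) \<in> S}"

primrec fv :: "proc \<Rightarrow> var set" where
  "fv PNil = {}"
| "fv (P \<parallel> Q) = fv P \<union> fv Q"
| "fv (RepInpB a ks P) = {Chan a} \<union> unshift (nbase ks) (nchan ks) (fv P)"
| "fv (InpB a ks P) = {Chan a} \<union> unshift (nbase ks) (nchan ks) (fv P)"
| "fv (Out a es) = {Chan a} \<union> (\<Union>e\<in>set es. fv_exp e)"
| "fv (NuB P) = unshift 0 1 (fv P)"
| "fv (MatchNatB e P Q) = fv_exp e \<union> fv P \<union> unshift 1 0 (fv Q)"
| "fv (MatchListB e P Q) = fv_exp e \<union> fv P \<union> unshift 2 0 (fv Q)"
| "fv (Ite e P Q) = fv_exp e \<union> fv P \<union> fv Q"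
| "fv (Tick P) = fv P"


section \<open>Named binding constructors\<close>

primrec bases :: "var list \<Rightarrow> nat list" where
  "bases [] = []"
| "bases (v # vs) = (case v of Base x \<Rightarrow> x # bases vs | Chan a \<Rightarrow> bases vs)"

primrec chans :: "var list \<Rightarrow> nat list" where
  "chans [] = []"
| "chans (v # vs) = (case v of Base x \<Rightarrow> chans vs | Chan a \<Rightarrow> a # chans vs)"

text \<open>The position of \<open>n\<close> in \<open>xs\<close> if \<open>n\<close> is a member of \<open>xs\<close>, and \<open>length xs + n\<close> otherwise.\<close>

primrec ix :: "nat list \<Rightarrow> nat \<Rightarrow> nat" where
  "ix [] n = n"
| "ix (x # xs) n = (if n = x then 0 else Suc (ix xs n))"

text \<open>
  The binding constructors are used with pairwise distinct bound variables, as usual for binders;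
  every process can be written in this way, see \<open>proc_exhaust\<close>.  The reduction rules
  state distinctness explicitly.

  \<open>bind\<close> turns the free variables \<open>vs\<close> of a process into the indices expected below a binder.
\<close>

definition bind :: "var list \<Rightarrow> proc \<Rightarrow> proc" where
  "bind vs = psubst (\<lambda>x. Var (Base (ix (bases vs) x))) (ix (chans vs))"

definition rep_inp :: "nat \<Rightarrow> var list \<Rightarrow> proc \<Rightarrow> proc" where
  "rep_inp a vs P = RepInpB a (map kind_of vs) (bind vs P)"

definition inp :: "nat \<Rightarrow> var list \<Rightarrow> proc \<Rightarrow> proc" where
  "inp a vs P = InpB a (map kind_of vs) (bind vs P)"

definition res :: "nat \<Rightarrow> proc \<Rightarrow> proc" where
  "res a P = NuB (bind [Chan a] P)"

text \<open>\<open>match_nat e P x Q\<close> is the match on \<open>e\<close> with branches \<open>0 \<mapsto> P\<close> and \<open>s(x) \<mapsto> Q\<close>;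
  \<open>match_list e P x y Q\<close> is the match on \<open>e\<close> with branches \<open>[] \<mapsto> P\<close> and \<open>x :: y \<mapsto> Q\<close>.\<close>

definition match_nat :: "exp \<Rightarrow> proc \<Rightarrow> nat \<Rightarrow> proc \<Rightarrow> proc" where
  "match_nat e P x Q = MatchNatB e P (bind [Base x] Q)"

definition match_list :: "exp \<Rightarrow> proc \<Rightarrow> nat \<Rightarrow> nat \<Rightarrow> proc \<Rightarrow> proc" where
  "match_list e P x y Q = MatchListB e P (bind [Base x, Base y] Q)"


subsection \<open>Adequacy of the representation\<close>

lemma esubst_cong:
  assumes "\<And>x. Base x \<in> fv_exp e \<Longrightarrow> \<beta> x = \<beta>' x"
    and "\<And>a. Chan a \<in> fv_exp e \<Longrightarrow> \<rho> a = \<rho>' a"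
  shows "esubst \<beta> \<rho> e = esubst \<beta>' \<rho>' e"
  using assms
proof (induction e)
  case (Var v) then show ?case by (cases v) auto
qed auto

lemma esubst_esubst:
  "esubst \<beta> \<rho> (esubst \<beta>' \<rho>' e) = esubst (\<lambda>x. esubst \<beta> \<rho> (\<beta>' x)) (\<lambda>a. \<rho> (\<rho>' a)) e"
proof (induction e)
  case (Var v) then show ?case by (cases v) auto
qed auto

lemma esubst_id: "esubst (\<lambda>x. Var (Base x)) (\<lambda>a. a) e = e"
proof (induction e)
  case (Var v) then show ?case by (cases v) auto
qed auto

lemma lift_base_cong:
  assumes "\<And>x. Base x \<in> unshift k l S \<Longrightarrow> \<beta> x = \<beta>' x" "Base x \<in> S"
  shows "lift_base k l \<beta> x = lift_base k l \<beta>' x"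
proof (cases "x < k")
  case False
  then have "Base (x - k) \<in> unshift k l S" using assms(2) by (auto simp: unshift_def)
  with assms(1) show ?thesis by (simp add: lift_base_def)
qed (simp add: lift_base_def)

lemma lift_chan_cong:
  assumes "\<And>a. Chan a \<in> unshift k l S \<Longrightarrow> \<rho> a = \<rho>' a" "Chan a \<in> S"
  shows "lift_chan l \<rho> a = lift_chan l \<rho>' a"
proof (cases "a < l")
  case False
  then have "Chan (a - l) \<in> unshift k l S" using assms(2) by (auto simp: unshift_def)
  with assms(1) show ?thesis by (simp add: lift_chan_def)
qed (simp add: lift_chan_def)

lemma psubst_cong:
  assumes "\<And>x. Base x \<in> fv P \<Longrightarrow> \<beta> x = \<beta>' x"
    and "\<And>a. Chan a \<in> fv P \<Longrightarrow> \<rho> a = \<rho>' a"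
  shows "psubst \<beta> \<rho> P = psubst \<beta>' \<rho>' P"
  using assms
proof (induction P arbitrary: \<beta> \<beta>' \<rho> \<rho>')
  case (Par P Q)
  have "psubst \<beta> \<rho> P = psubst \<beta>' \<rho>' P" "psubst \<beta> \<rho> Q = psubst \<beta>' \<rho>' Q"
    by (rule Par.IH; simp add: Par.prems)+
  then show ?case by simp
next
  case (RepInpB a ks P)
  have "psubst (lift_base (nbase ks) (nchan ks) \<beta>) (lift_chan (nchan ks) \<rho>) P
      = psubst (lift_base (nbase ks) (nchan ks) \<beta>') (lift_chan (nchan ks) \<rho>') P"
    by (rule RepInpB.IH; erule lift_base_cong[rotated] lift_chan_cong[where k = "nbase ks", rotated])
      (simp_all add: RepInpB.prems)
  then show ?case by (simp add: RepInpB.prems)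
next
  case (InpB a ks P)
  have "psubst (lift_base (nbase ks) (nchan ks) \<beta>) (lift_chan (nchan ks) \<rho>) P
      = psubst (lift_base (nbase ks) (nchan ks) \<beta>') (lift_chan (nchan ks) \<rho>') P"
    by (rule InpB.IH; erule lift_base_cong[rotated] lift_chan_cong[where k = "nbase ks", rotated])
      (simp_all add: InpB.prems)
  then show ?case by (simp add: InpB.prems)
next
  case (Out a es)
  have "esubst \<beta> \<rho> e = esubst \<beta>' \<rho>' e" if "e \<in> set es" for e
    by (rule esubst_cong) (use that Out.prems in auto)
  then show ?case by (simp add: Out.prems)
next
  case (NuB P)
  have "psubst (lift_base 0 1 \<beta>) (lift_chan 1 \<rho>) P
      = psubst (lift_base 0 1 \<beta>') (lift_chan 1 \<rho>') P"
    by (rule NuB.IH; erule lift_base_cong[rotated] lift_chan_cong[where k = "0", rotated])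
      (simp_all add: NuB.prems)
  then show ?case by simp
next
  case (MatchNatB e P Q)
  have "psubst (lift_base 1 0 \<beta>) (lift_chan 0 \<rho>) Q
      = psubst (lift_base 1 0 \<beta>') (lift_chan 0 \<rho>') Q"
    by (rule MatchNatB.IH(2); erule lift_base_cong[rotated] lift_chan_cong[where k = "1", rotated])
      (simp_all add: MatchNatB.prems)
  moreover have "psubst \<beta> \<rho> P = psubst \<beta>' \<rho>' P"
    by (rule MatchNatB.IH(1); simp add: MatchNatB.prems)
  moreover have "esubst \<beta> \<rho> e = esubst \<beta>' \<rho>' e"
    by (rule esubst_cong; simp add: MatchNatB.prems)
  ultimately show ?case by simp
next
  case (MatchListB e P Q)
  have "psubst (lift_base 2 0 \<beta>) (lift_chan 0 \<rho>) Q
      = psubst (lift_base 2 0 \<beta>') (lift_chan 0 \<rho>') Q"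
    by (rule MatchListB.IH(2); erule lift_base_cong[rotated] lift_chan_cong[where k = "2", rotated])
      (simp_all add: MatchListB.prems)
  moreover have "psubst \<beta> \<rho> P = psubst \<beta>' \<rho>' P"
    by (rule MatchListB.IH(1); simp add: MatchListB.prems)
  moreover have "esubst \<beta> \<rho> e = esubst \<beta>' \<rho>' e"
    by (rule esubst_cong; simp add: MatchListB.prems)
  ultimately show ?case by simp
next
  case (Ite e P Q)
  have "psubst \<beta> \<rho> P = psubst \<beta>' \<rho>' P" "psubst \<beta> \<rho> Q = psubst \<beta>' \<rho>' Q"
    by (rule Ite.IH; simp add: Ite.prems)+
  moreover have "esubst \<beta> \<rho> e = esubst \<beta>' \<rho>' e"
    by (rule esubst_cong; simp add: Ite.prems)
  ultimately show ?case by simp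
next
  case (Tick P)
  have "psubst \<beta> \<rho> P = psubst \<beta>' \<rho>' P"
    by (rule Tick.IH; simp add: Tick.prems)
  then show ?case by simp
qed simp

lemma lift_base_lift_base:
  "esubst (lift_base k l \<beta>) (lift_chan l \<rho>) (lift_base k l \<beta>' x)
     = lift_base k l (\<lambda>x. esubst \<beta> \<rho> (\<beta>' x)) x"
  by (auto simp: lift_base_def lift_chan_def esubst_esubst)

lemma lift_chan_lift_chan:
  "lift_chan l \<rho> (lift_chan l \<rho>' a) = lift_chan l (\<lambda>a. \<rho> (\<rho>' a)) a"
  by (simp add: lift_chan_def)

lemma psubst_psubst:
  "psubst \<beta> \<rho> (psubst \<beta>' \<rho>' P) = psubst (\<lambda>x. esubst \<beta> \<rho> (\<beta>' x)) (\<lambda>a. \<rho> (\<rho>' a)) P"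
  by (induction P arbitrary: \<beta> \<beta>' \<rho> \<rho>')
    (simp_all add: esubst_esubst lift_base_lift_base lift_chan_lift_chan)

lemma psubst_id: "psubst (\<lambda>x. Var (Base x)) (\<lambda>a. a) P = P"
proof -
  have [simp]: "lift_base k l (\<lambda>x. Var (Base x)) = (\<lambda>x. Var (Base x))" for k l
    by (auto simp: lift_base_def fun_eq_iff)
  have [simp]: "lift_chan l (\<lambda>a. a) = (\<lambda>a. a)" for l
    by (auto simp: lift_chan_def fun_eq_iff)
  show ?thesis by (induction P) (simp_all add: esubst_id map_idI)
qed

lemma finite_fv_exp: "finite (fv_exp e)"
  by (induction e) auto

lemma finite_unshift: "finite S \<Longrightarrow> finite (unshift k l S)"
proof -
  assume S: "finite S"
  have "inj (\<lambda>x. Base (k + x))" "inj (\<lambda>x. Chan (l + x))"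
    by (auto simp: inj_def)
  from this[THEN finite_vimageI[OF S]]
  show ?thesis
    unfolding unshift_def by (auto simp: vimage_def setcompr_eq_image)
qed

lemma finite_fv: "finite (fv P)"
  by (induction P) (auto simp: finite_fv_exp finite_unshift)

lemma length_bases: "length (bases vs) = nbase (map kind_of vs)"
  by (induction vs) (auto split: var.splits)

lemma length_chans: "length (chans vs) = nchan (map kind_of vs)"
  by (induction vs) (auto split: var.splits)

lemma set_bases: "x \<in> set (bases vs) \<longleftrightarrow> Base x \<in> set vs"
  by (induction vs) (auto split: var.splits)

lemma set_chans: "a \<in> set (chans vs) \<longleftrightarrow> Chan a \<in> set vs"
  by (induction vs) (auto split: var.splits)

lemma distinct_bases: "distinct vs \<Longrightarrow> distinct (bases vs)"
  by (induction vs) (auto simp: set_bases split: var.splits)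

lemma distinct_chans: "distinct vs \<Longrightarrow> distinct (chans vs)"
  by (induction vs) (auto simp: set_chans split: var.splits)

lemma ix_notin: "n \<notin> set xs \<Longrightarrow> ix xs n = length xs + n"
  by (induction xs) auto

lemma ix_nth: "distinct xs \<Longrightarrow> i < length xs \<Longrightarrow> ix xs (xs ! i) = i"
proof (induction xs arbitrary: i)
  case (Cons x xs)
  then show ?case by (cases i) auto
qed simp

lemma ix_less: "n \<in> set xs \<Longrightarrow> ix xs n < length xs"
  by (induction xs) auto

lemma nth_ix: "n \<in> set xs \<Longrightarrow> xs ! ix xs n = n"
  by (induction xs) auto

text \<open>A vector of pairwise distinct names of prescribed kinds can be chosen fresh.\<close>

lemma fresh_vars:
  assumes "finite S"
  shows "\<exists>vs. map kind_of vs = ks \<and> distinct vs \<and> set vs \<inter> S = {}"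
proof (induction ks)
  case (Cons k ks)
  then obtain vs where vs: "map kind_of vs = ks" "distinct vs" "set vs \<inter> S = {}" by blast
  have fin: "finite (S \<union> set vs)" using assms by simp
  have "\<exists>v. kind_of v = k \<and> v \<notin> S \<union> set vs"
  proof (cases k)
    case KBase
    have "\<exists>x. x \<notin> Base -` (S \<union> set vs)"
      using finite_vimageI[OF fin, of Base] by (intro ex_new_if_finite) (auto simp: inj_def)
    then show ?thesis using KBase by (metis kind_of.simps(1) vimageI)
  next
    case KChan
    have "\<exists>x. x \<notin> Chan -` (S \<union> set vs)"
      using finite_vimageI[OF fin, of Chan] by (intro ex_new_if_finite) (auto simp: inj_def)
    then show ?thesis using KChan by (metis kind_of.simps(2) vimageI)
  qed
  then obtain v where "kind_of v = k" "v \<notin> S \<union> set vs" by blast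
  with vs show ?case by (intro exI[of _ "v # vs"]) auto
qed simp

text \<open>
  Every body of a binder arises from \<open>bind\<close>, with freely chosen fresh names \<open>vs\<close>; hence the
  named constructors exhaust the type.
\<close>

lemma bind_surj:
  assumes "distinct vs"
    and "set vs \<inter> unshift (nbase (map kind_of vs)) (nchan (map kind_of vs)) (fv X) = {}"
  shows "\<exists>P. X = bind vs P"
proof -
  define un where "un xs n = (if n < length xs then xs ! n else n - length xs)" for xs and n :: nat
  have un: "ix xs (un xs n) = n"
    if "distinct xs" "n < length xs \<or> n - length xs \<notin> set xs" for xs n
    using that ix_nth[of xs n] ix_notin[of "n - length xs" xs] by (auto simp: un_def)
  have b: "ix (bases vs) (un (bases vs) x) = x" if "Base x \<in> fv X" for x
  proof (rule un)
    show "distinct (bases vs)" using assms(1) by (rule distinct_bases)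
    have "x - length (bases vs) \<notin> set (bases vs)" if "\<not> x < length (bases vs)"
    proof -
      have "Base (x - length (bases vs))
          \<in> unshift (nbase (map kind_of vs)) (nchan (map kind_of vs)) (fv X)"
        using \<open>Base x \<in> fv X\<close> that by (simp add: unshift_def length_bases)
      with assms(2) show ?thesis by (auto simp: set_bases)
    qed
    then show "x < length (bases vs) \<or> x - length (bases vs) \<notin> set (bases vs)" by blast
  qed
  have c: "ix (chans vs) (un (chans vs) x) = x" if "Chan x \<in> fv X" for x
  proof (rule un)
    show "distinct (chans vs)" using assms(1) by (rule distinct_chans)
    have "x - length (chans vs) \<notin> set (chans vs)" if "\<not> x < length (chans vs)"
    proof -
      have "Chan (x - length (chans vs))
          \<in> unshift (nbase (map kind_of vs)) (nchan (map kind_of vs)) (fv X)"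
        using \<open>Chan x \<in> fv X\<close> that by (simp add: unshift_def length_chans)
      with assms(2) show ?thesis by (auto simp: set_chans)
    qed
    then show "x < length (chans vs) \<or> x - length (chans vs) \<notin> set (chans vs)" by blast
  qed
  have "bind vs (psubst (\<lambda>x. Var (Base (un (bases vs) x))) (un (chans vs)) X)
      = psubst (\<lambda>x. Var (Base x)) (\<lambda>a. a) X"
    unfolding bind_def psubst_psubst by (rule psubst_cong) (simp_all add: b c)
  then show ?thesis unfolding psubst_id by metis
qed

lemma bind_exhaust:
  assumes "finite S"
  shows "\<exists>vs P. map kind_of vs = ks \<and> distinct vs \<and> set vs \<inter> S = {} \<and> X = bind vs P"
proof -
  have "finite (S \<union> unshift (nbase ks) (nchan ks) (fv X))"
    using assms by (simp add: finite_unshift finite_fv)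
  from fresh_vars[OF this, of ks] obtain vs where vs: "map kind_of vs = ks" "distinct vs"
    "set vs \<inter> (S \<union> unshift (nbase ks) (nchan ks) (fv X)) = {}" by blast
  then have "\<exists>P. X = bind vs P" by (intro bind_surj) auto
  with vs show ?thesis by blast
qed

theorem proc_exhaust:
  assumes "finite S"
  obtains "R = PNil"
  | P Q where "R = P \<parallel> Q"
  | a vs P where "R = rep_inp a vs P" "distinct vs" "set vs \<inter> S = {}"
  | a vs P where "R = inp a vs P" "distinct vs" "set vs \<inter> S = {}"
  | a es where "R = Out a es"
  | a P where "R = res a P" "Chan a \<notin> S"
  | e P x Q where "R = match_nat e P x Q" "Base x \<notin> S"
  | e P x y Q where "R = match_list e P x y Q" "x \<noteq> y" "Base x \<notin> S" "Base y \<notin> S"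
  | e P Q where "R = Ite e P Q"
  | P where "R = Tick P"
proof (cases R)
  case (RepInpB a ks X)
  then show ?thesis
    using bind_exhaust[OF assms, of ks X] that(3) unfolding rep_inp_def by blast
next
  case (InpB a ks X)
  then show ?thesis
    using bind_exhaust[OF assms, of ks X] that(4) unfolding inp_def by blast
next
  case (NuB X)
  obtain vs P where vs: "map kind_of vs = [KChan]" "set vs \<inter> S = {}" "X = bind vs P"
    using bind_exhaust[OF assms] by blast
  then obtain v where "vs = [v]" "kind_of v = KChan" by auto
  with vs NuB show ?thesis using that(6) by (cases v) (auto simp: res_def)
next
  case (MatchNatB e P X)
  obtain vs Q where vs: "map kind_of vs = [KBase]" "set vs \<inter> S = {}" "X = bind vs Q"
    using bind_exhaust[OF assms] by blast
  then obtain v where "vs = [v]" "kind_of v = KBase" by auto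
  with vs MatchNatB show ?thesis using that(7) by (cases v) (auto simp: match_nat_def)
next
  case (MatchListB e P X)
  obtain vs Q where vs: "map kind_of vs = [KBase, KBase]" "distinct vs" "set vs \<inter> S = {}"
    "X = bind vs Q"
    using bind_exhaust[OF assms] by blast
  then obtain v w where "vs = [v, w]" "kind_of v = KBase" "kind_of w = KBase" by auto
  with vs MatchListB show ?thesis using that(8)
    by (cases v; cases w) (auto simp: match_list_def)
qed (use that in auto)

text \<open>Free variables of the named constructors.\<close>

primrec vren :: "(nat \<Rightarrow> nat) \<Rightarrow> (nat \<Rightarrow> nat) \<Rightarrow> var \<Rightarrow> var" where
  "vren f g (Base x) = Base (f x)"
| "vren f g (Chan a) = Chan (g a)"

lemma fv_esubst_ren: "fv_exp (esubst (\<lambda>x. Var (Base (f x))) g e) = vren f g ` fv_exp e"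
proof (induction e)
  case (Var v) then show ?case by (cases v) auto
qed auto

lemma lift_base_ren:
  "lift_base k l (\<lambda>x. Var (Base (f x)))
     = (\<lambda>x. Var (Base (if x < k then x else k + f (x - k))))"
  by (auto simp: lift_base_def fun_eq_iff)

lemma Base_vren: "Base y \<in> vren f g ` S \<longleftrightarrow> (\<exists>x. y = f x \<and> Base x \<in> S)"
proof
  assume "Base y \<in> vren f g ` S"
  then obtain v where "v \<in> S" "Base y = vren f g v" by blast
  then show "\<exists>x. y = f x \<and> Base x \<in> S" by (cases v) auto
next
  assume "\<exists>x. y = f x \<and> Base x \<in> S"
  then obtain x where "y = f x" "Base x \<in> S" by blast
  with imageI[of "Base x" S "vren f g"] show "Base y \<in> vren f g ` S" by simp
qed

lemma Chan_vren: "Chan b \<in> vren f g ` S \<longleftrightarrow> (\<exists>a. b = g a \<and> Chan a \<in> S)"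
proof
  assume "Chan b \<in> vren f g ` S"
  then obtain v where "v \<in> S" "Chan b = vren f g v" by blast
  then show "\<exists>a. b = g a \<and> Chan a \<in> S" by (cases v) auto
next
  assume "\<exists>a. b = g a \<and> Chan a \<in> S"
  then obtain a where "b = g a" "Chan a \<in> S" by blast
  with imageI[of "Chan a" S "vren f g"] show "Chan b \<in> vren f g ` S" by simp
qed

lemma Base_unshift: "Base x \<in> unshift k l S \<longleftrightarrow> Base (k + x) \<in> S"
  by (simp add: unshift_def)

lemma Chan_unshift: "Chan a \<in> unshift k l S \<longleftrightarrow> Chan (l + a) \<in> S"
  by (simp add: unshift_def)

lemma unshift_ren:
  "unshift k l (vren (\<lambda>x. if x < k then x else k + f (x - k)) (lift_chan l g) ` S)
   = vren f g ` unshift k l S"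
proof -
  have *: "(\<exists>x. k + y = (if x < k then x else k + f (x - k)) \<and> c x)
      \<longleftrightarrow> (\<exists>x. y = f x \<and> c (k + x))" for k y c and f :: "nat \<Rightarrow> nat"
  proof
    assume "\<exists>x. k + y = (if x < k then x else k + f (x - k)) \<and> c x"
    then obtain x where x: "k + y = (if x < k then x else k + f (x - k))" "c x" by blast
    then have "\<not> x < k" by auto
    with x show "\<exists>x. y = f x \<and> c (k + x)" by (intro exI[of _ "x - k"]) auto
  next
    assume "\<exists>x. y = f x \<and> c (k + x)"
    then obtain x where "y = f x" "c (k + x)" by blast
    then show "\<exists>x. k + y = (if x < k then x else k + f (x - k)) \<and> c x"
      by (intro exI[of _ "k + x"]) auto
  qed
  have "v \<in> unshift k l (vren (\<lambda>x. if x < k then x else k + f (x - k)) (lift_chan l g) ` S)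
      \<longleftrightarrow> v \<in> vren f g ` unshift k l S" for v
    using *[of k _ f "\<lambda>x. Base x \<in> S"] *[of l _ g "\<lambda>x. Chan x \<in> S"]
    by (cases v) (simp_all only: Base_unshift Chan_unshift Base_vren Chan_vren lift_chan_def)
  then show ?thesis by blast
qed

lemma fv_psubst_ren: "fv (psubst (\<lambda>x. Var (Base (f x))) g P) = vren f g ` fv P"
  by (induction P arbitrary: f g)
    (simp_all only: psubst.simps fv.simps lift_base_ren unshift_ren fv_esubst_ren image_Un
      image_insert image_empty image_UN vren.simps set_map image_image)

lemma ix_ge: "length xs + n = ix xs m \<longleftrightarrow> n = m \<and> m \<notin> set xs"
  using ix_less[of m xs] ix_notin[of m xs] by (cases "m \<in> set xs") auto

lemma fv_bind: "unshift (nbase (map kind_of vs)) (nchan (map kind_of vs)) (fv (bind vs P))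
  = fv P - set vs"
proof -
  have "v \<in> unshift (nbase (map kind_of vs)) (nchan (map kind_of vs)) (fv (bind vs P))
      \<longleftrightarrow> v \<in> fv P - set vs" for v
    by (cases v)
      (auto simp: Base_unshift Chan_unshift Base_vren Chan_vren bind_def fv_psubst_ren ix_ge
        set_bases set_chans simp flip: length_bases length_chans)
  then show ?thesis by blast
qed

lemma fv_named:
  "fv (rep_inp a vs P) = {Chan a} \<union> (fv P - set vs)"
  "fv (inp a vs P) = {Chan a} \<union> (fv P - set vs)"
  "fv (res a P) = fv P - {Chan a}"
  "fv (match_nat e P x Q) = fv_exp e \<union> fv P \<union> (fv Q - {Base x})"
  "fv (match_list e P x y Q) = fv_exp e \<union> fv P \<union> (fv Q - {Base x, Base y})"
  using fv_bind[of "[Chan a]" P] fv_bind[of "[Base x]" Q] fv_bind[of "[Base x, Base y]" Q]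
  by (simp_all add: rep_inp_def inp_def res_def match_nat_def match_list_def fv_bind
      numeral_2_eq_2)

text \<open>Alpha-conversion is an equality between processes built with the named constructors.\<close>

lemma map_of_zip_ix:
  assumes "distinct vs" "map kind_of vs = map kind_of ws" "distinct ws"
  shows "case map_of (zip vs (map Var ws)) v of
      None \<Rightarrow> v \<notin> set vs
    | Some e \<Rightarrow> \<exists>w. e = Var w \<and> v \<in> set vs \<and> w \<in> set ws \<and> kind_of w = kind_of v
        \<and> (\<forall>x y. v = Base x \<longrightarrow> w = Base y \<longrightarrow> ix (bases ws) y = ix (bases vs) x)
        \<and> (\<forall>x y. v = Chan x \<longrightarrow> w = Chan y \<longrightarrow> ix (chans ws) y = ix (chans vs) x)"
proof -
  have "length vs = length ws" using assms(2) by (metis length_map)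
  then show ?thesis using assms
  proof (induction vs ws rule: list_induct2)
    case (Cons v' vs w' ws)
    note IH = Cons.IH
    show ?case
    proof (cases "v = v'")
      case True
      with Cons.prems show ?thesis by auto
    next
      case False
      show ?thesis
      proof (cases "map_of (zip vs (map Var ws)) v")
        case None
        with IH Cons.prems False show ?thesis by simp
      next
        case (Some e)
        with Cons.IH Cons.prems obtain w where
          "e = Var w" "v \<in> set vs" "w \<in> set ws" "kind_of w = kind_of v"
          "\<And>x y. v = Base x \<Longrightarrow> w = Base y \<Longrightarrow> ix (bases ws) y = ix (bases vs) x"
          "\<And>x y. v = Chan x \<Longrightarrow> w = Chan y \<Longrightarrow> ix (chans ws) y = ix (chans vs) x"
          by auto
        moreover have "w \<noteq> w'" using calculation(3) Cons.prems by auto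
        ultimately show ?thesis using Some False Cons.prems
          by (cases v'; cases w') auto
      qed
    qed
  qed simp
qed

lemma bind_alpha:
  assumes "distinct vs" "distinct ws" "map kind_of vs = map kind_of ws"
    and "set ws \<inter> (fv P - set vs) = {}"
  shows "bind vs P = bind ws (P[vs ::= map Var ws])"
  unfolding bind_def subst_def psubst_psubst
proof (rule psubst_cong)
  fix x assume x: "Base x \<in> fv P"
  show "Var (Base (ix (bases vs) x))
    = esubst (\<lambda>x. Var (Base (ix (bases ws) x))) (ix (chans ws)) (subst_base vs (map Var ws) x)"
  proof (cases "map_of (zip vs (map Var ws)) (Base x)")
    case None
    then have "Base x \<notin> set vs" using map_of_zip_ix[OF assms(1,3,2), of "Base x"] by simp
    moreover from this x assms(4) have "Base x \<notin> set ws" by blast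
    ultimately show ?thesis using None
      by (simp add: subst_base_def ix_notin set_bases length_bases assms(3))
  next
    case (Some e)
    then show ?thesis using map_of_zip_ix[OF assms(1,3,2), of "Base x"]
      by (auto simp: subst_base_def elim!: kind_of.elims)
  qed
next
  fix x assume x: "Chan x \<in> fv P"
  show "ix (chans vs) x = ix (chans ws) (subst_chan vs (map Var ws) x)"
  proof (cases "map_of (zip vs (map Var ws)) (Chan x)")
    case None
    then have "Chan x \<notin> set vs" using map_of_zip_ix[OF assms(1,3,2), of "Chan x"] by simp
    moreover from this x assms(4) have "Chan x \<notin> set ws" by blast
    ultimately show ?thesis using None
      by (simp add: subst_chan_def ix_notin set_chans length_chans assms(3))
  next
    case (Some e)
    then show ?thesis using map_of_zip_ix[OF assms(1,3,2), of "Chan x"]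
      by (auto simp: subst_chan_def elim!: kind_of.elims)
  qed
qed

theorem alpha_conversion:
  "\<lbrakk>distinct vs; distinct ws; map kind_of vs = map kind_of ws; set ws \<inter> (fv P - set vs) = {}\<rbrakk>
    \<Longrightarrow> rep_inp a vs P = rep_inp a ws (P[vs ::= map Var ws])"
  "\<lbrakk>distinct vs; distinct ws; map kind_of vs = map kind_of ws; set ws \<inter> (fv P - set vs) = {}\<rbrakk>
    \<Longrightarrow> inp a vs P = inp a ws (P[vs ::= map Var ws])"
  "Chan c \<notin> fv P - {Chan b} \<Longrightarrow> res b P = res c (P[[Chan b] ::= [Var (Chan c)]])"
  "Base z \<notin> fv Q - {Base x} \<Longrightarrow>
    match_nat e P x Q = match_nat e P z (Q[[Base x] ::= [Var (Base z)]])"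
  "\<lbrakk>x \<noteq> y; z \<noteq> w; {Base z, Base w} \<inter> (fv Q - {Base x, Base y}) = {}\<rbrakk> \<Longrightarrow>
    match_list e P x y Q
      = match_list e P z w (Q[[Base x, Base y] ::= [Var (Base z), Var (Base w)]])"
  using bind_alpha[of vs ws P] bind_alpha[of "[Chan b]" "[Chan c]" P]
    bind_alpha[of "[Base x]" "[Base z]" Q] bind_alpha[of "[Base x, Base y]" "[Base z, Base w]" Q]
  by (simp_all add: rep_inp_def inp_def res_def match_nat_def match_list_def)


text \<open>The substitution of the calculus passes through binders of fresh names.\<close>

lemma bind_psubst:
  assumes "\<And>x. Base x \<in> set ws \<Longrightarrow> \<beta> x = Var (Base x)"
    and "\<And>a. Chan a \<in> set ws \<Longrightarrow> \<rho> a = a"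
    and "\<And>x. Base x \<notin> set ws \<Longrightarrow> fv_exp (\<beta> x) \<inter> set ws = {}"
    and "\<And>a. Chan a \<notin> set ws \<Longrightarrow> Chan (\<rho> a) \<notin> set ws"
  defines "k \<equiv> nbase (map kind_of ws)" and "l \<equiv> nchan (map kind_of ws)"
  shows "psubst (lift_base k l \<beta>) (lift_chan l \<rho>) (bind ws P) = bind ws (psubst \<beta> \<rho> P)"
proof -
  have k: "k = length (bases ws)" and l: "l = length (chans ws)"
    by (simp_all add: k_def l_def length_bases length_chans)
  have "lift_base k l \<beta> (ix (bases ws) x)
      = esubst (\<lambda>x. Var (Base (ix (bases ws) x))) (ix (chans ws)) (\<beta> x)" for x
  proof (cases "Base x \<in> set ws")
    case True
    then show ?thesis using assms(1) ix_less[of x "bases ws"]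
      by (simp add: lift_base_def k set_bases)
  next
    case False
    have "esubst (\<lambda>x. Var (Base (k + x))) (\<lambda>a. l + a) (\<beta> x)
      = esubst (\<lambda>x. Var (Base (ix (bases ws) x))) (ix (chans ws)) (\<beta> x)"
    proof (rule esubst_cong)
      fix y assume "Base y \<in> fv_exp (\<beta> x)"
      with assms(3)[OF False] have "y \<notin> set (bases ws)" by (auto simp: set_bases)
      then show "Var (Base (k + y)) = Var (Base (ix (bases ws) y))" by (simp add: ix_notin k)
    next
      fix b assume "Chan b \<in> fv_exp (\<beta> x)"
      with assms(3)[OF False] have "b \<notin> set (chans ws)" by (auto simp: set_chans)
      then show "l + b = ix (chans ws) b" by (simp add: ix_notin l)
    qed
    with False show ?thesis by (simp add: lift_base_def k ix_notin set_bases)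
  qed
  moreover have "lift_chan l \<rho> (ix (chans ws) a) = ix (chans ws) (\<rho> a)" for a
    using assms(2,4)[of a] ix_less[of a "chans ws"]
    by (cases "Chan a \<in> set ws") (simp_all add: lift_chan_def l ix_notin set_chans)
  ultimately show ?thesis by (simp add: bind_def psubst_psubst)
qed

lemma bind_subst:
  assumes "set ws \<inter> (set vs \<union> (\<Union>e\<in>set es. fv_exp e)) = {}"
  shows "psubst (lift_base (nbase (map kind_of ws)) (nchan (map kind_of ws)) (subst_base vs es))
      (lift_chan (nchan (map kind_of ws)) (subst_chan vs es)) (bind ws P)
    = bind ws (P[vs ::= es])"
  unfolding subst_def
proof (rule bind_psubst)
  have dom: "map_of (zip vs es) v = None" if "v \<in> set ws" for v
    using that assms by (auto simp: map_of_eq_None_iff dest: set_zip_leftD)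
  have ran: "fv_exp e \<inter> set ws = {}" if "map_of (zip vs es) v = Some e" for v e
    using assms set_zip_rightD[OF map_of_SomeD[OF that]] by blast
  show "subst_base vs es x = Var (Base x)" if "Base x \<in> set ws" for x
    using dom[OF that] by (simp add: subst_base_def)
  show "subst_chan vs es a = a" if "Chan a \<in> set ws" for a
    using dom[OF that] by (simp add: subst_chan_def)
  show "fv_exp (subst_base vs es x) \<inter> set ws = {}" if "Base x \<notin> set ws" for x
    using that ran by (auto simp: subst_base_def split: option.splits)
  show "Chan (subst_chan vs es a) \<notin> set ws" if "Chan a \<notin> set ws" for a
    using that ran[of "Chan a"]
    by (auto simp: subst_chan_def split: option.splits exp.splits var.splits)
qed

theorem subst_named:
  "set ws \<inter> (set vs \<union> (\<Union>e\<in>set es. fv_exp e)) = {} \<Longrightarrow>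
    (rep_inp a ws P)[vs ::= es] = rep_inp (subst_chan vs es a) ws (P[vs ::= es])"
  "set ws \<inter> (set vs \<union> (\<Union>e\<in>set es. fv_exp e)) = {} \<Longrightarrow>
    (inp a ws P)[vs ::= es] = inp (subst_chan vs es a) ws (P[vs ::= es])"
  "Chan a \<notin> set vs \<union> (\<Union>e\<in>set es. fv_exp e) \<Longrightarrow>
    (res a P)[vs ::= es] = res a (P[vs ::= es])"
  "Base x \<notin> set vs \<union> (\<Union>e\<in>set es. fv_exp e) \<Longrightarrow>
    (match_nat e P x Q)[vs ::= es]
      = match_nat (esubst (subst_base vs es) (subst_chan vs es) e)
          (P[vs ::= es]) x (Q[vs ::= es])"
  "{Base x, Base y} \<inter> (set vs \<union> (\<Union>e\<in>set es. fv_exp e)) = {} \<Longrightarrow>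
    (match_list e P x y Q)[vs ::= es]
      = match_list (esubst (subst_base vs es) (subst_chan vs es) e)
          (P[vs ::= es]) x y (Q[vs ::= es])"
  using bind_subst[of ws vs es P] bind_subst[of "[Chan a]" vs es P]
    bind_subst[of "[Base x]" vs es Q] bind_subst[of "[Base x, Base y]" vs es Q]
  by (simp_all add: subst_def rep_inp_def inp_def res_def match_nat_def match_list_def
      numeral_2_eq_2)


section \<open>Structural congruence\<close>

inductive scong :: "proc \<Rightarrow> proc \<Rightarrow> bool"  (infix \<open>\<cong>\<close> 50) where
  par_nil: "P \<parallel> PNil \<cong> P"
| par_comm: "P \<parallel> Q \<cong> Q \<parallel> P"
| par_assoc: "P \<parallel> (Q \<parallel> R) \<cong> (P \<parallel> Q) \<parallel> R"
| res_swap: "res a (res b P) \<cong> res b (res a P)"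
| res_par: "Chan a \<notin> fv Q \<Longrightarrow> res a (P \<parallel> Q) \<cong> res a P \<parallel> Q"
| refl: "P \<cong> P"
| sym: "P \<cong> Q \<Longrightarrow> Q \<cong> P"
| trans: "P \<cong> Q \<Longrightarrow> Q \<cong> R \<Longrightarrow> P \<cong> R"
| cong_par: "P \<cong> P' \<Longrightarrow> Q \<cong> Q' \<Longrightarrow> P \<parallel> Q \<cong> P' \<parallel> Q'"
| cong_rep_inp: "P \<cong> P' \<Longrightarrow> rep_inp a vs P \<cong> rep_inp a vs P'"
| cong_inp: "P \<cong> P' \<Longrightarrow> inp a vs P \<cong> inp a vs P'"
| cong_res: "P \<cong> P' \<Longrightarrow> res a P \<cong> res a P'"
| cong_match_nat: "P \<cong> P' \<Longrightarrow> Q \<cong> Q' \<Longrightarrow> match_nat e P x Q \<cong> match_nat e P' x Q'"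
| cong_match_list: "P \<cong> P' \<Longrightarrow> Q \<cong> Q' \<Longrightarrow> match_list e P x y Q \<cong> match_list e P' x y Q'"
| cong_if: "P \<cong> P' \<Longrightarrow> Q \<cong> Q' \<Longrightarrow> Ite e P Q \<cong> Ite e P' Q'"
| cong_tick: "P \<cong> P' \<Longrightarrow> Tick P \<cong> Tick P'"


section \<open>Reduction\<close>

inductive step :: "proc \<Rightarrow> proc \<Rightarrow> bool"  (infix \<open>\<longmapsto>\<close> 50) where
  rep_comm: "distinct vs \<Longrightarrow> subst_ok vs es \<Longrightarrow>
    rep_inp a vs P \<parallel> Out a es \<longmapsto> rep_inp a vs P \<parallel> P[vs ::= es]"
| comm: "distinct vs \<Longrightarrow> subst_ok vs es \<Longrightarrow> inp a vs P \<parallel> Out a es \<longmapsto> P[vs ::= es]"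
| nat_zero: "match_nat Zero P x Q \<longmapsto> P"
| nat_succ: "match_nat (Succ e) P x Q \<longmapsto> Q[[Base x] ::= [e]]"
| list_nil: "match_list ENil P x y Q \<longmapsto> P"
| list_cons: "x \<noteq> y \<Longrightarrow> match_list (ECons e e') P x y Q \<longmapsto> Q[[Base x, Base y] ::= [e, e']]"
| if_true: "Ite TT P Q \<longmapsto> P"
| if_false: "Ite FF P Q \<longmapsto> Q"
| par: "P \<longmapsto> Q \<Longrightarrow> P \<parallel> R \<longmapsto> Q \<parallel> R"
| res: "P \<longmapsto> Q \<Longrightarrow> res a P \<longmapsto> res a Q"
| struct: "P \<cong> P' \<Longrightarrow> P' \<longmapsto> Q' \<Longrightarrow> Q' \<cong> Q \<Longrightarrow> P \<longmapsto> Q"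

abbreviation steps :: "proc \<Rightarrow> proc \<Rightarrow> bool"  (infix \<open>\<longmapsto>*\<close> 50) where
  "P \<longmapsto>* Q \<equiv> step\<^sup>*\<^sup>* P Q"

definition normal_form :: "proc \<Rightarrow> bool" where
  "normal_form P \<longleftrightarrow> (\<nexists>Q. P \<longmapsto> Q)"


section \<open>Time reduction and the tick-last strategy\<close>

inductive time_red :: "proc \<Rightarrow> proc \<Rightarrow> bool"  (infix \<open>\<Rrightarrow>\<close> 50) where
  "PNil \<Rrightarrow> PNil"
| "rep_inp a vs P \<Rrightarrow> rep_inp a vs P"
| "inp a vs P \<Rrightarrow> inp a vs P"
| "Out a es \<Rrightarrow> Out a es"
| "match_nat e P x Q \<Rrightarrow> match_nat e P x Q"
| "match_list e P x y Q \<Rrightarrow> match_list e P x y Q"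
| "Ite e P Q \<Rrightarrow> Ite e P Q"
| "Tick P \<Rrightarrow> P"
| "P \<Rrightarrow> P' \<Longrightarrow> Q \<Rrightarrow> Q' \<Longrightarrow> P \<parallel> Q \<Rrightarrow> P' \<parallel> Q'"
| "P \<Rrightarrow> P' \<Longrightarrow> res a P \<Rrightarrow> res a P'"

inductive tick_last :: "proc \<Rightarrow> proc \<Rightarrow> bool" where
  stop: "P \<longmapsto>* P' \<Longrightarrow> normal_form P' \<Longrightarrow> P' \<Rrightarrow> P' \<Longrightarrow> tick_last P P'"
| continue: "P \<longmapsto>* P' \<Longrightarrow> normal_form P' \<Longrightarrow> \<not> P' \<Rrightarrow> P' \<Longrightarrow> P' \<Rrightarrow> R \<Longrightarrow> R \<noteq> P' \<Longrightarrow>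
    tick_last R Q \<Longrightarrow> tick_last P Q"


section \<open>Tick erasure\<close>

text \<open>
  Pre-processes are the processes without \<open>Tick\<close>.  Since the rules do not create ticks, reduction
  of pre-processes is the restriction of \<open>step\<close>.
\<close>

primrec pre_process :: "proc \<Rightarrow> bool" where
  "pre_process PNil \<longleftrightarrow> True"
| "pre_process (P \<parallel> Q) \<longleftrightarrow> pre_process P \<and> pre_process Q"
| "pre_process (RepInpB a ks P) \<longleftrightarrow> pre_process P"
| "pre_process (InpB a ks P) \<longleftrightarrow> pre_process P"
| "pre_process (Out a es) \<longleftrightarrow> True"
| "pre_process (NuB P) \<longleftrightarrow> pre_process P"
| "pre_process (MatchNatB e P Q) \<longleftrightarrow> pre_process P \<and> pre_process Q"
| "pre_process (MatchListB e P Q) \<longleftrightarrow> pre_process P \<and> pre_process Q"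
| "pre_process (Ite e P Q) \<longleftrightarrow> pre_process P \<and> pre_process Q"
| "pre_process (Tick P) \<longleftrightarrow> False"

primrec erase :: "proc \<Rightarrow> proc" where
  "erase PNil = PNil"
| "erase (P \<parallel> Q) = erase P \<parallel> erase Q"
| "erase (RepInpB a ks P) = RepInpB a ks (erase P)"
| "erase (InpB a ks P) = InpB a ks (erase P)"
| "erase (Out a es) = Out a es"
| "erase (NuB P) = NuB (erase P)"
| "erase (MatchNatB e P Q) = MatchNatB e (erase P) (erase Q)"
| "erase (MatchListB e P Q) = MatchListB e (erase P) (erase Q)"
| "erase (Ite e P Q) = Ite e (erase P) (erase Q)"
| "erase (Tick P) = erase P"

lemma erase_psubst: "erase (psubst \<beta> \<rho> P) = psubst \<beta> \<rho> (erase P)"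
  by (induction P arbitrary: \<beta> \<rho>) simp_all

lemma erase_named:
  "erase (rep_inp a vs P) = rep_inp a vs (erase P)"
  "erase (inp a vs P) = inp a vs (erase P)"
  "erase (res a P) = res a (erase P)"
  "erase (match_nat e P x Q) = match_nat e (erase P) x (erase Q)"
  "erase (match_list e P x y Q) = match_list e (erase P) x y (erase Q)"
  by (simp_all add: rep_inp_def inp_def res_def match_nat_def match_list_def bind_def erase_psubst)

lemma pre_process_erase: "pre_process (erase P)"
  by (induction P) simp_all

lemma pre_process_psubst [simp]: "pre_process (psubst \<beta> \<rho> P) \<longleftrightarrow> pre_process P"
  by (induction P arbitrary: \<beta> \<rho>) simp_all

lemma pre_process_named:
  "pre_process (rep_inp a vs P) \<longleftrightarrow> pre_process P"
  "pre_process (inp a vs P) \<longleftrightarrow> pre_process P"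
  "pre_process (res a P) \<longleftrightarrow> pre_process P"
  "pre_process (match_nat e P x Q) \<longleftrightarrow> pre_process P \<and> pre_process Q"
  "pre_process (match_list e P x y Q) \<longleftrightarrow> pre_process P \<and> pre_process Q"
  by (simp_all add: rep_inp_def inp_def res_def match_nat_def match_list_def bind_def)

lemma pre_process_scong: "P \<cong> Q \<Longrightarrow> pre_process P \<longleftrightarrow> pre_process Q"
  by (induction rule: scong.induct) (auto simp: pre_process_named)

lemma pre_process_step: "P \<longmapsto> Q \<Longrightarrow> pre_process P \<Longrightarrow> pre_process Q"
  by (induction rule: step.induct)
    (auto simp: pre_process_named subst_def dest: pre_process_scong)

end

theory Submission
  imports Defs
begin

text \<open>
  Tick erasure preserves structural congruence and reduction, and it identifies the two sides of a
  time reduction; this gives the reduction from \<open>erase P\<close> to \<open>erase Q\<close>.  The converse direction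
  needed for normal forms cannot be obtained by lifting structural congruences along \<open>erase\<close>, since
  a tick below a guard may block the regrouping of parallel components.  Instead, reducibility is
  characterised by a recursive predicate \<open>redex\<close> that inspects only the unguarded part of a process
  and is invariant under structural congruence.  If \<open>Q \<Rrightarrow> Q\<close>, then no tick of \<open>Q\<close> is unguarded, so
  \<open>Q\<close> and \<open>erase Q\<close> have the same unguarded part and \<open>redex\<close> does not distinguish them.
\<close>

section \<open>Erasure and reduction\<close>

text \<open>Keeps the freshness condition of scope extrusion valid after erasure.\<close>

lemma fv_erase [simp]: "fv (erase P) = fv P"
  by (induction P) simp_all

lemma erase_subst: "erase (P[vs ::= es]) = (erase P)[vs ::= es]"
  by (simp add: subst_def erase_psubst)

lemma erase_scong: "P \<cong> Q \<Longrightarrow> erase P \<cong> erase Q"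
  by (induction rule: scong.induct) (auto simp: erase_named intro: scong.intros)

lemma erase_step: "P \<longmapsto> Q \<Longrightarrow> erase P \<longmapsto> erase Q"
proof (induction rule: step.induct)
  case (struct P P' Q' Q)
  then show ?case by (blast intro: step.struct erase_scong)
qed (simp_all add: erase_named erase_subst step.intros)

lemma erase_steps: "P \<longmapsto>* Q \<Longrightarrow> erase P \<longmapsto>* erase Q"
  by (induction rule: rtranclp_induct) (auto intro: rtranclp.rtrancl_into_rtrancl erase_step)

lemma erase_time_red: "P \<Rrightarrow> Q \<Longrightarrow> erase P = erase Q"
  by (induction rule: time_red.induct) (simp_all add: erase_named)

section \<open>Unguarded ticks\<close>

text \<open>A measure invariant under substitution. In \<open>res b P'\<close> the process
  \<open>P'\<close> is only a renaming of the body below \<open>NuB\<close>, not necessarily a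
  subterm, so inductions through named restrictions use this measure.\<close>

primrec nodes :: "proc \<Rightarrow> nat" where
  "nodes PNil = 1"
| "nodes (P \<parallel> Q) = Suc (nodes P + nodes Q)"
| "nodes (RepInpB a ks P) = Suc (nodes P)"
| "nodes (InpB a ks P) = Suc (nodes P)"
| "nodes (Out a es) = 1"
| "nodes (NuB P) = Suc (nodes P)"
| "nodes (MatchNatB e P Q) = Suc (nodes P + nodes Q)"
| "nodes (MatchListB e P Q) = Suc (nodes P + nodes Q)"
| "nodes (Ite e P Q) = Suc (nodes P + nodes Q)"
| "nodes (Tick P) = Suc (nodes P)"

lemma nodes_psubst [simp]: "nodes (psubst \<beta> \<rho> P) = nodes P"
  by (induction P arbitrary: \<beta> \<rho>) simp_all

lemma nodes_res [simp]: "nodes (res a P) = Suc (nodes P)"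
  by (simp add: res_def bind_def)

primrec ticks_guarded :: "proc \<Rightarrow> bool" where
  "ticks_guarded PNil \<longleftrightarrow> True"
| "ticks_guarded (P \<parallel> Q) \<longleftrightarrow> ticks_guarded P \<and> ticks_guarded Q"
| "ticks_guarded (RepInpB a ks P) \<longleftrightarrow> True"
| "ticks_guarded (InpB a ks P) \<longleftrightarrow> True"
| "ticks_guarded (Out a es) \<longleftrightarrow> True"
| "ticks_guarded (NuB P) \<longleftrightarrow> ticks_guarded P"
| "ticks_guarded (MatchNatB e P Q) \<longleftrightarrow> True"
| "ticks_guarded (MatchListB e P Q) \<longleftrightarrow> True"
| "ticks_guarded (Ite e P Q) \<longleftrightarrow> True"
| "ticks_guarded (Tick P) \<longleftrightarrow> False"

lemma ticks_guarded_psubst [simp]: "ticks_guarded (psubst \<beta> \<rho> P) = ticks_guarded P"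
  by (induction P arbitrary: \<beta> \<rho>) simp_all

lemma ticks_guarded_res [simp]: "ticks_guarded (res a P) = ticks_guarded P"
  by (simp add: res_def bind_def)

text \<open>Every unguarded tick fires and loses its node, and no other clause adds nodes. Counting
  thus excludes unguarded ticks in a process with \<open>Q \<Rrightarrow> Q\<close>.\<close>

lemma time_red_nodes:
  "P \<Rrightarrow> Q \<Longrightarrow> nodes Q \<le> nodes P \<and> (\<not> ticks_guarded P \<longrightarrow> nodes Q < nodes P)"
  by (induction rule: time_red.induct)
    (auto simp: rep_inp_def inp_def match_nat_def match_list_def)

lemma time_red_self: "Q \<Rrightarrow> Q \<Longrightarrow> ticks_guarded Q"
  using time_red_nodes by blast

section \<open>Unguarded redexes\<close>

text \<open>
  The kinds of the parameters of an input and the Boolean vector telling which arguments of an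
  output are channel names decide whether the communication is well-defined, see
  \<open>subst_ok_compatible\<close>; unlike the arguments, they are not affected by renaming.
\<close>

primrec inputs :: "proc \<Rightarrow> (nat \<times> kind list) set" where
  "inputs PNil = {}"
| "inputs (P \<parallel> Q) = inputs P \<union> inputs Q"
| "inputs (RepInpB a ks P) = {(a, ks)}"
| "inputs (InpB a ks P) = {(a, ks)}"
| "inputs (Out a es) = {}"
| "inputs (NuB P) = {(a, ks). (Suc a, ks) \<in> inputs P}"
| "inputs (MatchNatB e P Q) = {}"
| "inputs (MatchListB e P Q) = {}"
| "inputs (Ite e P Q) = {}"
| "inputs (Tick P) = {}"

definition is_chan :: "exp \<Rightarrow> bool" where
  "is_chan e \<longleftrightarrow> (\<exists>b. e = Var (Chan b))"

primrec outputs :: "proc \<Rightarrow> (nat \<times> bool list) set" where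
  "outputs PNil = {}"
| "outputs (P \<parallel> Q) = outputs P \<union> outputs Q"
| "outputs (RepInpB a ks P) = {}"
| "outputs (InpB a ks P) = {}"
| "outputs (Out a es) = {(a, map is_chan es)}"
| "outputs (NuB P) = {(a, bs). (Suc a, bs) \<in> outputs P}"
| "outputs (MatchNatB e P Q) = {}"
| "outputs (MatchListB e P Q) = {}"
| "outputs (Ite e P Q) = {}"
| "outputs (Tick P) = {}"

definition compatible :: "kind list \<Rightarrow> bool list \<Rightarrow> bool" where
  "compatible = list_all2 (\<lambda>k b. k = KChan \<longrightarrow> b)"

lemma subst_ok_compatible: "subst_ok vs es \<longleftrightarrow> compatible (map kind_of vs) (map is_chan es)"
proof -
  have "kind_of v = KChan \<longleftrightarrow> (\<exists>a. v = Chan a)" for v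
    by (cases v) auto
  then show ?thesis
    by (auto simp: subst_ok_def compatible_def is_chan_def list_all2_map1 list_all2_map2)
qed

definition communicates :: "proc \<Rightarrow> proc \<Rightarrow> bool" where
  "communicates P Q \<longleftrightarrow>
     (\<exists>a ks bs. (a, ks) \<in> inputs P \<and> (a, bs) \<in> outputs Q \<and> compatible ks bs)"

primrec redex :: "proc \<Rightarrow> bool" where
  "redex PNil \<longleftrightarrow> False"
| "redex (P \<parallel> Q) \<longleftrightarrow> redex P \<or> redex Q \<or> communicates P Q \<or> communicates Q P"
| "redex (RepInpB a ks P) \<longleftrightarrow> False"
| "redex (InpB a ks P) \<longleftrightarrow> False"
| "redex (Out a es) \<longleftrightarrow> False"
| "redex (NuB P) \<longleftrightarrow> redex P"
| "redex (MatchNatB e P Q) \<longleftrightarrow> e = Zero \<or> (\<exists>e'. e = Succ e')"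
| "redex (MatchListB e P Q) \<longleftrightarrow> e = ENil \<or> (\<exists>e' e''. e = ECons e' e'')"
| "redex (Ite e P Q) \<longleftrightarrow> e = TT \<or> e = FF"
| "redex (Tick P) \<longleftrightarrow> False"

subsection \<open>Renaming\<close>

lemma vsubst_ren: "vsubst (\<lambda>x. Var (Base (f x))) g v = Var (vren f g v)"
  by (cases v) simp_all

lemma is_chan_ren: "is_chan (esubst (\<lambda>x. Var (Base (f x))) g e) = is_chan e"
proof (cases e)
  case (Var v)
  then show ?thesis by (cases v) (simp_all add: is_chan_def)
qed (simp_all add: is_chan_def)

text \<open>A renaming puts variables for variables, so the head constructor of an expression is
  unchanged; a general substitution could create a redex here.\<close>

lemma esubst_ren_eq:
  "esubst (\<lambda>x. Var (Base (f x))) g e = Zero \<longleftrightarrow> e = Zero"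
  "(\<exists>e'. esubst (\<lambda>x. Var (Base (f x))) g e = Succ e') \<longleftrightarrow> (\<exists>e'. e = Succ e')"
  "esubst (\<lambda>x. Var (Base (f x))) g e = ENil \<longleftrightarrow> e = ENil"
  "(\<exists>e' e''. esubst (\<lambda>x. Var (Base (f x))) g e = ECons e' e'')
    \<longleftrightarrow> (\<exists>e' e''. e = ECons e' e'')"
  "esubst (\<lambda>x. Var (Base (f x))) g e = TT \<longleftrightarrow> e = TT"
  "esubst (\<lambda>x. Var (Base (f x))) g e = FF \<longleftrightarrow> e = FF"
  by (cases e; simp add: vsubst_ren)+

lemma Suc_lift_chan: "Suc b = lift_chan (Suc 0) g c \<longleftrightarrow> (\<exists>a. c = Suc a \<and> b = g a)"
  by (cases c) (auto simp: lift_chan_def)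

lemma inj_lift_chan: "inj g \<Longrightarrow> inj (lift_chan l g)"
  unfolding inj_def lift_chan_def
  by (metis add_left_cancel diff_add_inverse le_add_diff_inverse not_less le_add1)

lemma inputs_ren:
  "(b, ks) \<in> inputs (psubst (\<lambda>x. Var (Base (f x))) g P) \<longleftrightarrow> (\<exists>a. b = g a \<and> (a, ks) \<in> inputs P)"
  by (induction P arbitrary: f g b) (auto simp: lift_base_ren Suc_lift_chan)

lemma outputs_ren:
  "(b, bs) \<in> outputs (psubst (\<lambda>x. Var (Base (f x))) g P) \<longleftrightarrow> (\<exists>a. b = g a \<and> (a, bs) \<in> outputs P)"
  by (induction P arbitrary: f g b)
    (auto simp: lift_base_ren Suc_lift_chan is_chan_ren comp_def)

text \<open>Injectivity matters: merging two channels could create a communication.\<close>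

lemma communicates_ren:
  assumes "inj g"
  shows "communicates (psubst (\<lambda>x. Var (Base (f x))) g P) (psubst (\<lambda>x. Var (Base (f x))) g Q)
    \<longleftrightarrow> communicates P Q"
  unfolding communicates_def inputs_ren outputs_ren using assms by (metis injD)

lemma redex_ren: "inj g \<Longrightarrow> redex (psubst (\<lambda>x. Var (Base (f x))) g P) = redex P"
  by (induction P arbitrary: f g)
    (simp_all add: communicates_ren esubst_ren_eq lift_base_ren inj_lift_chan)

lemma inj_ix: "inj (ix [a])"
  by (auto simp: inj_def split: if_splits)

text \<open>\<open>ix [a]\<close> sends \<open>a\<close> to 0 and any other \<open>b\<close> to
  \<open>Suc b\<close>, while \<open>NuB\<close> keeps exactly the successors.\<close>

lemma inputs_res: "(b, ks) \<in> inputs (res a P) \<longleftrightarrow> b \<noteq> a \<and> (b, ks) \<in> inputs P"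
  by (auto simp: res_def bind_def inputs_ren split: if_splits)

lemma outputs_res: "(b, bs) \<in> outputs (res a P) \<longleftrightarrow> b \<noteq> a \<and> (b, bs) \<in> outputs P"
  by (auto simp: res_def bind_def outputs_ren split: if_splits)

lemma redex_res [simp]: "redex (res a P) = redex P"
  by (simp only: res_def bind_def redex.simps chans.simps var.case redex_ren[OF inj_ix])

subsection \<open>Redexes are necessary for reduction\<close>

lemma inputs_fv: "(a, ks) \<in> inputs P \<Longrightarrow> Chan a \<in> fv P"
  by (induction P arbitrary: a) (auto simp: Chan_unshift)

lemma outputs_fv: "(a, bs) \<in> outputs P \<Longrightarrow> Chan a \<in> fv P"
  by (induction P arbitrary: a) (auto simp: Chan_unshift)

lemma communicates_par:
  "communicates (P \<parallel> Q) R \<longleftrightarrow> communicates P R \<or> communicates Q R"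
  "communicates R (P \<parallel> Q) \<longleftrightarrow> communicates R P \<or> communicates R Q"
  by (auto simp: communicates_def)

lemma communicates_res:
  assumes "Chan a \<notin> fv Q"
  shows "communicates (res a P) Q = communicates P Q" "communicates Q (res a P) = communicates Q P"
  using assms inputs_fv[of a _ Q] outputs_fv[of a _ Q]
  unfolding communicates_def inputs_res outputs_res by metis+

text \<open>\<open>redex\<close> of a parallel composition depends on the inputs and outputs of its
  components, so all three invariants go through one induction.\<close>

lemma scong_redex:
  "P \<cong> Q \<Longrightarrow> inputs P = inputs Q \<and> outputs P = outputs Q \<and> redex P = redex Q"
proof (induction rule: scong.induct)
  case (par_nil P)
  then show ?case by (simp add: communicates_def)
next
  case (par_assoc P Q R)
  then show ?case by (auto simp: communicates_par)
next
  case (res_swap a b P)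
  then show ?case by (auto simp: inputs_res outputs_res)
next
  case (res_par a Q P)
  then show ?case
    by (auto simp: inputs_res outputs_res communicates_res dest: inputs_fv outputs_fv)
next
  case (cong_res P P' a)
  then show ?case by (auto simp: inputs_res outputs_res)
qed (auto simp: communicates_def rep_inp_def inp_def match_nat_def match_list_def)

lemma step_redex: "P \<longmapsto> Q \<Longrightarrow> redex P"
proof (induction rule: step.induct)
  case (struct P P' Q' Q)
  then show ?case using scong_redex by blast
qed (auto simp: communicates_def rep_inp_def inp_def match_nat_def match_list_def
      subst_ok_compatible)

subsection \<open>Redexes are sufficient for reduction\<close>

definition reducible :: "proc \<Rightarrow> bool" where
  "reducible P \<longleftrightarrow> (\<exists>Q. P \<longmapsto> Q)"

lemma reducible_scong: "P \<cong> Q \<Longrightarrow> reducible Q \<Longrightarrow> reducible P"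
  unfolding reducible_def by (blast intro: step.struct scong.refl)

lemma reducible_par1: "reducible P \<Longrightarrow> reducible (P \<parallel> Q)"
  unfolding reducible_def by (blast intro: step.par)

lemma reducible_par2: "reducible Q \<Longrightarrow> reducible (P \<parallel> Q)"
  using reducible_par1 reducible_scong scong.par_comm by blast

lemma reducible_res: "reducible P \<Longrightarrow> reducible (res a P)"
  unfolding reducible_def by (blast intro: step.res)

lemma reducible_res_par1: "Chan a \<notin> fv Q \<Longrightarrow> reducible (P \<parallel> Q) \<Longrightarrow> reducible (res a P \<parallel> Q)"
  by (blast intro: reducible_scong scong.sym scong.res_par reducible_res)

lemma reducible_par_comm: "reducible (P \<parallel> Q) \<Longrightarrow> reducible (Q \<parallel> P)"
  by (blast intro: reducible_scong scong.par_comm)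

lemma reducible_par_assoc: "reducible (P \<parallel> (Q \<parallel> R)) \<longleftrightarrow> reducible ((P \<parallel> Q) \<parallel> R)"
  by (blast intro: reducible_scong scong.par_assoc scong.sym)

text \<open>The output is moved inwards, by regrouping and scope extrusion, until it stands next to
  the matching input.\<close>

lemma reducible_input_Out:
  assumes "(a, ks) \<in> inputs P" "compatible ks (map is_chan es)"
  shows "reducible (P \<parallel> Out a es)"
  using assms(1)
proof (induction P rule: measure_induct_rule[of nodes])
  case (less P)
  show ?case
  \<comment> \<open>Bound names are chosen fresh for the output, so it may enter a
    restriction.\<close>
  proof (rule proc_exhaust[of "fv (Out a es)" P])
    show "finite (fv (Out a es))" by (rule finite_fv)
  next
    fix P1 P2 assume P: "P = P1 \<parallel> P2"
    with less have "reducible (P1 \<parallel> Out a es) \<or> reducible (P2 \<parallel> Out a es)" by auto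
    then show ?thesis
      unfolding P using reducible_par1 reducible_par2 reducible_par_comm reducible_par_assoc by blast
  next
    fix b vs P' assume "P = rep_inp b vs P'" "distinct vs"
    moreover from this less.prems assms(2) have "b = a" "subst_ok vs es"
      by (auto simp: rep_inp_def subst_ok_compatible)
    ultimately show ?thesis unfolding reducible_def by (blast intro: step.rep_comm)
  next
    fix b vs P' assume "P = inp b vs P'" "distinct vs"
    moreover from this less.prems assms(2) have "b = a" "subst_ok vs es"
      by (auto simp: inp_def subst_ok_compatible)
    ultimately show ?thesis unfolding reducible_def by (blast intro: step.comm)
  next
    fix b P' assume "P = res b P'" "Chan b \<notin> fv (Out a es)"
    with less show ?thesis
      by (auto simp: inputs_res intro!: reducible_res_par1)
  qed (use less.prems in \<open>auto simp: match_nat_def match_list_def\<close>)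
qed

text \<open>Symmetrically, \<open>P\<close> is moved inwards through \<open>Q\<close> until a single
  output remains, which is the preceding case.\<close>

lemma communicates_reducible: "communicates P Q \<Longrightarrow> reducible (P \<parallel> Q)"
proof (induction Q arbitrary: P rule: measure_induct_rule[of nodes])
  case (less Q)
  show ?case
  proof (rule proc_exhaust[of "fv P" Q])
    show "finite (fv P)" by (rule finite_fv)
  next
    fix Q1 Q2 assume Q: "Q = Q1 \<parallel> Q2"
    with less have "reducible (P \<parallel> Q1) \<or> reducible (P \<parallel> Q2)"
      by (auto simp: communicates_par)
    then show ?thesis
      unfolding Q using reducible_par1 reducible_par2 reducible_par_comm reducible_par_assoc by blast
  next
    fix a es assume "Q = Out a es"
    with less.prems show ?thesis
      by (auto simp: communicates_def intro: reducible_input_Out)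
  next
    fix b Q' assume Q: "Q = res b Q'" "Chan b \<notin> fv P"
    with less have "reducible (P \<parallel> Q')" by (simp add: communicates_res)
    with Q show ?thesis using reducible_par_comm reducible_res_par1 by blast
  qed (use less.prems in \<open>auto simp: communicates_def rep_inp_def inp_def match_nat_def
      match_list_def\<close>)
qed

lemma redex_reducible: "redex P \<Longrightarrow> reducible P"
proof (induction P rule: measure_induct_rule[of nodes])
  case (less P)
  show ?case
  proof (rule proc_exhaust[of "{}" P])
    fix P1 P2 assume P: "P = P1 \<parallel> P2"
    with less have "reducible P1 \<or> reducible P2 \<or> communicates P1 P2 \<or> communicates P2 P1"
      by auto
    then show ?thesis unfolding P
      using communicates_reducible reducible_par1 reducible_par2 reducible_par_comm by blast
  next
    fix b P' assume "P = res b P'"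
    with less show ?thesis by (auto intro: reducible_res)
  next
    fix e P' x Q' assume "P = match_nat e P' x Q'"
    with less.prems show ?thesis
      by (auto simp: reducible_def match_nat_def intro: step.intros[unfolded match_nat_def])
  next
    fix e P' x y Q' assume "P = match_list e P' x y Q'" "x \<noteq> y"
    with less.prems show ?thesis
      by (auto simp: reducible_def match_list_def intro: step.intros[unfolded match_list_def])
  next
    fix e P' Q' assume "P = Ite e P' Q'"
    with less.prems show ?thesis by (auto simp: reducible_def intro: step.intros)
  qed (use less.prems in \<open>auto simp: rep_inp_def inp_def\<close>)
qed

lemma normal_form_iff_redex: "normal_form P \<longleftrightarrow> \<not> redex P"
  using step_redex redex_reducible unfolding normal_form_def reducible_def by blast

section \<open>Erasure and normal forms\<close>

text \<open>The three functions never look below a guard, and outside the guards there is no tick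
  for \<open>erase\<close> to delete.\<close>

lemma erase_redex:
  "ticks_guarded P \<Longrightarrow>
    inputs (erase P) = inputs P \<and> outputs (erase P) = outputs P \<and> redex (erase P) = redex P"
  by (induction P) (auto simp: communicates_def)

lemma normal_form_erase: "normal_form Q \<Longrightarrow> Q \<Rrightarrow> Q \<Longrightarrow> normal_form (erase Q)"
  by (simp add: normal_form_iff_redex time_red_self erase_redex)

theorem theorem3p6:
  fixes P Q :: proc
  assumes "tick_last P Q"
  shows "normal_form Q \<and> Q \<Rrightarrow> Q \<and> erase P \<longmapsto>* erase Q \<and> normal_form (erase Q)"
  using assms
proof (induction rule: tick_last.induct)
  case (stop P P')
  then show ?case by (simp add: erase_steps normal_form_erase)
next
  case (continue P P' R Q)
  \<comment> \<open>The time reduction from \<open>P'\<close> to \<open>R\<close> becomes an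
    equality after erasure.\<close>
  then have "erase P \<longmapsto>* erase R" by (metis erase_steps erase_time_red)
  with continue.IH show ?case by (auto intro: rtranclp_trans)
qed

end
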